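(* Let $f$ be a transcendental entire function such that there exists $\rho>0$ with $m^n(\rho)\to\infty$ as $n\to\infty$. Then there exists $R>0$ such that $$\text{(1)}\qquad \widetilde m^{\,n}(R)\to\infty\ \text{ as } n\to\infty,$$ and, for any such $R$, there exists $r\ge R$ such that $$\text{(2)}\qquad m^n(r)\ge \widetilde m^{\,n}(R),\quad\text{for } n\in\mathbb{N}.$$ Moreover, for every $r$ and $R$ satisfying (1) and (2), the set $$\bigcup_{\ell\in\mathbb{N}_0} f^{-\ell}\left(\{z:|f^n(z)|\ge \widetilde m^{\,n}(R),\ \text{for } n\in\mathbb{N}\}\right)$$ is independent of the choice of $R$ and is equal to the set $$\bigcup_{\ell\in\mathbb{N}_0} f^{-\ell}\left(\{z:|f^n(z)|\ge m^n(r),\ \text{for } n\in\mathbb{N}\}\right).$$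
   Context: For the entire function $f$, $m(r)=\min_{|z|=r}|f(z)|$ and $\widetilde m(r)=\max_{0\le s\le r}m(s)$ for $r\in[0,\infty)$. $m^n$, $\widetilde m^{\,n}$ and $f^n$ denote $n$th iterates; $f^{-\ell}(E)$ is the preimage of $E$ under $f^\ell$. $\mathbb{N}=\{1,2,\dots\}$, $\mathbb{N}_0=\mathbb{N}\cup\{0\}$. *)

theory Defs
  imports "HOL-Complex_Analysis.Complex_Analysis" "HOL-Computational_Algebra.Polynomial"
begin

definition transcendental_entire :: "(complex \<Rightarrow> complex) \<Rightarrow> bool" where
  "transcendental_entire f \<longleftrightarrow>
     f holomorphic_on UNIV \<and> \<not> (\<exists>p :: complex poly. \<forall>z. f z = poly p z)"

(* For continuous f and r >= 0 the infimum below is attained, the circle being compact and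
   nonempty; min_mod f is then continuous on [0, oo), so the supremum is attained as well.
   For r < 0 both range over the empty set and the values are meaningless. *)

definition min_mod :: "(complex \<Rightarrow> complex) \<Rightarrow> real \<Rightarrow> real" where
  "min_mod f r = (INF z\<in>{z. norm z = r}. norm (f z))"

definition max_min_mod :: "(complex \<Rightarrow> complex) \<Rightarrow> real \<Rightarrow> real" where
  "max_min_mod f r = (SUP s\<in>{0..r}. min_mod f s)"

end

theory Submission
  imports Defs
begin

text \<open>
  Write \<open>m\<close> for the minimum modulus, \<open>M\<close> for its running maximum and \<open>R\<^sub>n = M\<^sup>n(R)\<close>.  Since \<open>M\<close> is
  nondecreasing, \<open>R\<^sub>n \<longlonglongrightarrow> \<infinity>\<close> forces \<open>M(x) > x\<close> for \<open>x \<ge> R\<close>, so \<open>R\<^sub>n\<close> increases strictly and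
  \<open>R\<^sub>n\<^sub>+\<^sub>2 = M(R\<^sub>n\<^sub>+\<^sub>1)\<close> is attained by \<open>m\<close> at some \<open>s\<^sub>n\<close> in \<open>(R\<^sub>n, R\<^sub>n\<^sub>+\<^sub>1]\<close>.  As \<open>m(R\<^sub>n) \<le> R\<^sub>n\<^sub>+\<^sub>1\<close>, the
  interval \<open>[R\<^sub>n, s\<^sub>n]\<close> covers \<open>[R\<^sub>n\<^sub>+\<^sub>1, s\<^sub>n\<^sub>+\<^sub>1]\<close> under \<open>m\<close>, and a nested intersection gives a point \<open>r\<close>
  with \<open>m\<^sup>n(r) \<ge> R\<^sub>n\<close>.  The union of preimages does not depend on \<open>R\<close>, because replacing \<open>z\<close> by
  \<open>f\<^sup>k(z)\<close> replaces \<open>R\<close> by \<open>R\<^sub>k\<close>, which exceeds any given \<open>R'\<close>; and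
  \<open>M\<^sup>n(R) \<le> m\<^sup>n(r) \<le> M\<^sup>n(r)\<close> gives the last equality.
\<close>

text \<open>A point of \<open>K (Suc k)\<close> that follows the later sets has a preimage in
  \<open>K k\<close>, so every finite itinerary is realised. The points realising longer and longer
  itineraries form nested nonempty compact sets, and any common point works.\<close>

lemma covering_orbit_exists:
  fixes K :: "nat \<Rightarrow> 'a::heine_borel set" and g :: "'a \<Rightarrow> 'a"
  assumes K: "\<And>n. compact (K n)" "\<And>n. K n \<noteq> {}"
    and cont: "\<And>n. continuous_on (K n) g"
    and cover: "\<And>n. K (Suc n) \<subseteq> g ` K n"
  obtains x where "\<And>n. (g ^^ n) x \<in> K n"
proof -
  \<comment> \<open>The offset \<open>k\<close> is there for the induction on \<open>N\<close>:
    removing the first step of an itinerary moves its start from \<open>K k\<close> to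
    \<open>K (Suc k)\<close>.\<close>
  define C where "C = (\<lambda>k N. {x. \<forall>n\<le>N. (g ^^ n) x \<in> K (k + n)})"
  have C_0: "C k 0 = K k" for k
    by (auto simp: C_def)
  have C_Suc: "C k (Suc N) = K k \<inter> g -` C (Suc k) N" for k N
    unfolding C_def
    by (auto simp: less_Suc_eq_le[symmetric] All_less_Suc2 funpow_Suc_right simp del: funpow.simps)
  have C: "compact (C k N) \<and> C k N \<noteq> {} \<and> C k N \<subseteq> K k" for k N
  proof (induction N arbitrary: k)
    case 0
    then show ?case using K by (simp add: C_0)
  next
    case (Suc N)
    have IH: "compact (C (Suc k) N)" "C (Suc k) N \<noteq> {}" "C (Suc k) N \<subseteq> K (Suc k)"
      using Suc by auto
    have "closed (C k (Suc N))"
      unfolding C_Suc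
      using continuous_closed_preimage[OF cont compact_imp_closed[OF K(1)] compact_imp_closed[OF IH(1)]] .
    then have "compact (C k (Suc N))"
      using K(1)[of k] compact_Int_closed[of "K k" "C k (Suc N)"]
      by (metis C_Suc inf.absorb2 inf_le1)
    moreover have "C k (Suc N) \<noteq> {}"
      using IH(2,3) cover[of k] unfolding C_Suc by blast
    ultimately show ?case by (auto simp: C_Suc)
  qed
  have "\<Inter>(range (C 0)) \<noteq> {}"
  proof (rule compact_nest)
    show "C 0 N \<subseteq> C 0 M" if "M \<le> N" for M N
      using that by (auto simp: C_def)
  qed (use C in auto)
  then obtain x where "\<And>N. x \<in> C 0 N" by blast
  then show thesis
    by (intro that[of x]) (auto simp: C_def)
qed

section \<open>Minimum modulus: bounds and continuity\<close>

lemma min_mod_nonneg: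
  assumes "r \<ge> 0"
  shows "min_mod f r \<ge> 0"
proof -
  have "{z::complex. norm z = r} \<noteq> {}"
    using assms by (auto intro!: exI[of _ "of_real r"])
  then show ?thesis
    unfolding min_mod_def by (intro cINF_greatest) auto
qed

lemma min_mod_le:
  assumes "norm z = r"
  shows "min_mod f r \<le> norm (f z)"
  unfolding min_mod_def
  by (rule cINF_lower) (use assms in \<open>auto intro!: bdd_belowI[of _ 0]\<close>)

text \<open>Two circles are compared along rays: points with the same direction are as close as the
  radii, and \<open>f\<close> is uniformly continuous on a closed disc containing both
  circles.\<close>

lemma continuous_on_min_mod:
  fixes f :: "complex \<Rightarrow> complex"
  assumes "continuous_on UNIV f"
  shows "continuous_on {0..} (min_mod f)"
proof -
  have half: "min_mod f r - e \<le> min_mod f s"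
    if rs: "r \<ge> 0" "s \<ge> 0"
      and close: "\<And>u. norm u = 1 \<Longrightarrow> dist (f (of_real r * u)) (f (of_real s * u)) \<le> e" for r s e
    unfolding min_mod_def[of f s]
  proof (rule cINF_greatest)
    show "{z::complex. norm z = s} \<noteq> {}"
      using rs by (auto intro!: exI[of _ "of_real s"])
  next
    fix z :: complex assume "z \<in> {z. norm z = s}"
    then have "norm z = s" by simp
    \<comment> \<open>The direction of \<open>z\<close>; at the origin any unit vector serves,
      whereas \<open>sgn 0 = 0\<close> would not have norm 1.\<close>
    define u where "u = (if z = 0 then 1 else sgn z)"
    have u: "norm u = 1" "z = of_real s * u"
      using \<open>norm z = s\<close> by (auto simp: u_def sgn_eq norm_divide)
    have "min_mod f r \<le> norm (f (of_real r * u))"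
      using u rs by (intro min_mod_le) (simp add: norm_mult)
    also have "\<dots> \<le> norm (f z) + e"
      using close[OF u(1)] norm_triangle_ineq2[of "f (of_real r * u)" "f z"]
      unfolding u(2) dist_norm by linarith
    finally show "min_mod f r - e \<le> norm (f z)" by simp
  qed
  have "continuous_on {0..B} (min_mod f)" for B
  proof (rule uniformly_continuous_imp_continuous, unfold uniformly_continuous_on_def, intro allI impI)
    fix e :: real assume "e > 0"
    have "uniformly_continuous_on (cball 0 B) f"
      using assms by (intro compact_uniformly_continuous) (auto intro: continuous_on_subset)
    then obtain d where d: "d > 0"
      "\<And>x y. x \<in> cball 0 B \<Longrightarrow> y \<in> cball 0 B \<Longrightarrow> dist y x < d \<Longrightarrow> dist (f y) (f x) < e / 2"
      unfolding uniformly_continuous_on_def using \<open>e > 0\<close> by (meson half_gt_zero)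
    show "\<exists>d>0. \<forall>x\<in>{0..B}. \<forall>x'\<in>{0..B}. dist x' x < d \<longrightarrow> dist (min_mod f x') (min_mod f x) < e"
    proof (intro exI[of _ d] conjI ballI impI d(1))
      fix x y assume xy: "x \<in> {0..B}" "y \<in> {0..B}" "dist y x < d"
      have close: "dist (f (of_real y * u)) (f (of_real x * u)) \<le> e / 2" if "norm u = 1" for u
      proof -
        have "dist (of_real y * u) (of_real x * u) = dist y x"
          using that by (simp add: dist_norm norm_mult flip: left_diff_distrib of_real_diff)
        then show ?thesis
          using xy that by (intro less_imp_le d(2)) (auto simp: norm_mult)
      qed
      have "min_mod f y - e / 2 \<le> min_mod f x" "min_mod f x - e / 2 \<le> min_mod f y"
        using xy close by (auto intro!: half simp: dist_commute)
      then show "dist (min_mod f y) (min_mod f x) < e"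
        using \<open>e > 0\<close> unfolding dist_real_def by linarith
    qed
  qed
  note cont = this
  show ?thesis
    unfolding continuous_on_eq_continuous_within
  proof
    fix x :: real assume "x \<in> {0..}"
    then have "continuous (at x within {0..x + 1}) (min_mod f)"
      using cont[of "x + 1"]
      by (simp add: continuous_on_eq_continuous_within)
    \<comment> \<open>Continuity is local, and \<open>x\<close> lies strictly below the right end of
      \<open>{0..x + 1}\<close>.\<close>
    moreover have "at x within {0..} = at x within {0..x + 1}"
      by (rule at_within_nhd[of _ "{..<x + 1}"]) auto
    ultimately show "continuous (at x within {0..}) (min_mod f)"
      by (simp add: continuous_within)
  qed
qed

text \<open>A general sequence \<open>a\<close> in place of the iterates lets both unions of the
  theorem be instances of one set.\<close>

definition fast_set :: "(complex \<Rightarrow> complex) \<Rightarrow> (nat \<Rightarrow> real) \<Rightarrow> complex set" where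
  "fast_set f a = (\<Union>l. (f ^^ l) -` {z. \<forall>n\<ge>1. norm ((f ^^ n) z) \<ge> a n})"

lemma fast_set_antimono:
  assumes "\<And>n. n \<ge> 1 \<Longrightarrow> a n \<le> b n"
  shows "fast_set f b \<subseteq> fast_set f a"
proof -
  have "{z. \<forall>n\<ge>1. norm ((f ^^ n) z) \<ge> b n} \<subseteq> {z. \<forall>n\<ge>1. norm ((f ^^ n) z) \<ge> a n}"
    using assms order_trans by blast
  then show ?thesis
    unfolding fast_set_def by blast
qed

text \<open>Going \<open>k\<close> steps further along the orbit of \<open>z\<close> discards the
  first \<open>k\<close> bounds; the union over \<open>l\<close> absorbs these steps.\<close>

lemma fast_set_shift: "fast_set f a \<subseteq> fast_set f (\<lambda>n. a (n + k))"
proof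
  fix z assume "z \<in> fast_set f a"
  then obtain l where l: "\<And>n. n \<ge> 1 \<Longrightarrow> norm ((f ^^ n) ((f ^^ l) z)) \<ge> a n"
    by (auto simp: fast_set_def)
  have "norm ((f ^^ n) ((f ^^ (k + l)) z)) \<ge> a (n + k)" if "n \<ge> 1" for n
    using l[of "n + k"] that by (simp add: funpow_add)
  then show "z \<in> fast_set f (\<lambda>n. a (n + k))"
    unfolding fast_set_def by blast
qed

section \<open>Running maximum of the minimum modulus and its iterates\<close>

context
  fixes f :: "complex \<Rightarrow> complex"
  assumes cont_f: "continuous_on UNIV f"
begin

lemma max_min_mod_attained:
  assumes "r \<ge> 0"
  obtains s where "0 \<le> s" "s \<le> r" "max_min_mod f r = min_mod f s"
    and "\<And>t. 0 \<le> t \<Longrightarrow> t \<le> r \<Longrightarrow> min_mod f t \<le> max_min_mod f r"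
proof -
  have "continuous_on {0..r} (min_mod f)"
    using continuous_on_min_mod[OF cont_f] by (rule continuous_on_subset) auto
  then obtain s where s: "s \<in> {0..r}" "\<And>t. t \<in> {0..r} \<Longrightarrow> min_mod f t \<le> min_mod f s"
    using continuous_attains_sup[of "{0..r}" "min_mod f"] assms by auto
  then have "max_min_mod f r = min_mod f s"
    unfolding max_min_mod_def by (intro cSup_eq_maximum) auto
  then show thesis using that[of s] s by auto
qed

lemma min_mod_le_max_min_mod:
  assumes "0 \<le> t" "t \<le> r"
  shows "min_mod f t \<le> max_min_mod f r"
  by (rule max_min_mod_attained[of r]) (use assms in auto)

lemma max_min_mod_mono:
  assumes "0 \<le> r" "r \<le> s"
  shows "max_min_mod f r \<le> max_min_mod f s"
proof -
  obtain t where "0 \<le> t" "t \<le> r" "max_min_mod f r = min_mod f t"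
    using max_min_mod_attained[OF assms(1)] .
  then show ?thesis
    using min_mod_le_max_min_mod[of t s] assms by simp
qed

lemma max_min_mod_nonneg: "r \<ge> 0 \<Longrightarrow> max_min_mod f r \<ge> 0"
  using min_mod_le_max_min_mod[of r r] min_mod_nonneg[of r f] by simp

lemma funpow_max_min_mod_nonneg: "r \<ge> 0 \<Longrightarrow> (max_min_mod f ^^ n) r \<ge> 0"
  by (induction n) (simp_all add: max_min_mod_nonneg)

lemma funpow_min_mod_nonneg: "r \<ge> 0 \<Longrightarrow> (min_mod f ^^ n) r \<ge> 0"
  by (induction n) (simp_all add: min_mod_nonneg)

lemma funpow_max_min_mod_mono:
  "0 \<le> r \<Longrightarrow> r \<le> s \<Longrightarrow> (max_min_mod f ^^ n) r \<le> (max_min_mod f ^^ n) s"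
  by (induction n) (simp_all add: max_min_mod_mono funpow_max_min_mod_nonneg)

lemma funpow_min_mod_le: "r \<ge> 0 \<Longrightarrow> (min_mod f ^^ n) r \<le> (max_min_mod f ^^ n) r"
  by (induction n) (simp_all add: min_mod_le_max_min_mod funpow_min_mod_nonneg)

text \<open>Otherwise monotonicity keeps the orbit of \<open>x\<close> at or below \<open>x\<close>,
  and with it the smaller orbit of \<open>R\<close>, which is unbounded.\<close>

lemma max_min_mod_gt:
  assumes "R \<ge> 0" "x \<ge> R"
    and lim: "filterlim (\<lambda>n. (max_min_mod f ^^ n) R) at_top sequentially"
  shows "max_min_mod f x > x"
proof (rule ccontr)
  assume *: "\<not> max_min_mod f x > x"
  have "(max_min_mod f ^^ n) x \<le> x" for n
  proof (induction n)
    case (Suc n)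
    then have "max_min_mod f ((max_min_mod f ^^ n) x) \<le> max_min_mod f x"
      using assms by (intro max_min_mod_mono funpow_max_min_mod_nonneg) auto
    then show ?case using * by simp
  qed simp
  then have "(max_min_mod f ^^ n) R \<le> x" for n
    using funpow_max_min_mod_mono[OF assms(1,2)] order_trans by blast
  moreover obtain n where "(max_min_mod f ^^ n) R > x"
    using lim by (metis filterlim_at_top_dense eventually_sequentially order_refl)
  ultimately show False by (meson not_less)
qed

lemma min_mod_orbit_dominates:
  assumes R: "R \<ge> 0"
    and lim: "filterlim (\<lambda>n. (max_min_mod f ^^ n) R) at_top sequentially"
  obtains r where "r \<ge> R" "\<And>n. (min_mod f ^^ n) r \<ge> (max_min_mod f ^^ n) R"
proof -
  define a where "a = (\<lambda>n. (max_min_mod f ^^ n) R)"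
  have a_Suc: "a (Suc n) = max_min_mod f (a n)" for n
    by (simp add: a_def)
  have a_ge: "a n \<ge> R" for n
    by (induction n) (use R lim in \<open>auto simp: a_def intro: order_trans less_imp_le[OF max_min_mod_gt]\<close>)
  have a_less: "a n < a (Suc n)" for n
    unfolding a_Suc using max_min_mod_gt[OF R a_ge lim] .
  have "\<exists>s. a n < s \<and> s \<le> a (Suc n) \<and> min_mod f s = a (Suc (Suc n))" for n
  proof -
    obtain s where s: "0 \<le> s" "s \<le> a (Suc n)" "a (Suc (Suc n)) = min_mod f s"
      using max_min_mod_attained[of "a (Suc n)"] a_ge[of "Suc n"] R
      unfolding a_Suc[of "Suc n"] by (metis order_trans)
    \<comment> \<open>If \<open>s \<le> a n\<close>, then \<open>min_mod f s\<close> is at most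
      \<open>a (Suc n)\<close>, which is less than \<open>a (Suc (Suc n))\<close>.\<close>
    have "a n < s"
      using min_mod_le_max_min_mod[OF s(1), of "a n"] a_less[of "Suc n"] s(3) a_Suc[of n]
      by (metis not_less)
    with s(2,3) show ?thesis by metis
  qed
  then obtain s where s: "\<And>n. a n < s n" "\<And>n. s n \<le> a (Suc n)" "\<And>n. min_mod f (s n) = a (Suc (Suc n))"
    by metis
  have cont: "continuous_on {a n..s n} (min_mod f)" for n
    using continuous_on_min_mod[OF cont_f]
    by (rule continuous_on_subset) (use a_ge[of n] R in auto)
  have cover: "{a (Suc n)..s (Suc n)} \<subseteq> min_mod f ` {a n..s n}" for n
  proof
    fix y assume y: "y \<in> {a (Suc n)..s (Suc n)}"
    have "min_mod f (a n) \<le> a (Suc n)"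
      unfolding a_Suc using a_ge[of n] R by (intro min_mod_le_max_min_mod) auto
    \<comment> \<open>The upper bound is the chain
      \<open>y \<le> s (Suc n) \<le> a (Suc (Suc n)) = min_mod f (s n)\<close>.\<close>
    then have "min_mod f (a n) \<le> y" "y \<le> min_mod f (s n)"
      using y s(2)[of "Suc n"] s(3)[of n] by auto
    then show "y \<in> min_mod f ` {a n..s n}"
      using IVT'[of "min_mod f" "a n" y "s n"] s(1)[of n] cont[of n] by auto
  qed
  obtain r where r: "\<And>n. (min_mod f ^^ n) r \<in> {a n..s n}"
    by (rule covering_orbit_exists[of "\<lambda>n. {a n..s n}" "min_mod f"])
      (use s(1) cont cover in \<open>auto simp: less_imp_le\<close>)
  show thesis
  proof (rule that)
    show "r \<ge> R" using r[of 0] by (simp add: a_def)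
    show "(min_mod f ^^ n) r \<ge> (max_min_mod f ^^ n) R" for n
      using r[of n] by (simp add: a_def)
  qed
qed

text \<open>Used in both directions for independence of \<open>R\<close>; as \<open>R'\<close> may
  be any nonnegative radius, it also applies with \<open>R' = r\<close> in the comparison with the
  orbit of \<open>r\<close> under \<open>min_mod f\<close>.\<close>

lemma fast_set_max_min_mod_subset:
  assumes "R \<ge> 0" "R' \<ge> 0"
    and lim: "filterlim (\<lambda>n. (max_min_mod f ^^ n) R) at_top sequentially"
  shows "fast_set f (\<lambda>n. (max_min_mod f ^^ n) R) \<subseteq> fast_set f (\<lambda>n. (max_min_mod f ^^ n) R')"
proof -
  obtain k where "(max_min_mod f ^^ k) R \<ge> R'"
    using lim by (metis filterlim_at_top eventually_sequentially order_refl)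
  then have "(max_min_mod f ^^ n) R' \<le> (max_min_mod f ^^ (n + k)) R" for n
    using funpow_max_min_mod_mono[OF assms(2)] by (simp add: funpow_add)
  then show ?thesis
    by (intro order_trans[OF fast_set_shift[of f _ k] fast_set_antimono])
qed

lemma fast_set_min_mod_eq:
  assumes "R \<ge> 0" "r \<ge> 0"
    and lim: "filterlim (\<lambda>n. (max_min_mod f ^^ n) R) at_top sequentially"
    and ge: "\<And>n. n \<ge> 1 \<Longrightarrow> (min_mod f ^^ n) r \<ge> (max_min_mod f ^^ n) R"
  shows "fast_set f (\<lambda>n. (max_min_mod f ^^ n) R) = fast_set f (\<lambda>n. (min_mod f ^^ n) r)"
proof
  have "fast_set f (\<lambda>n. (max_min_mod f ^^ n) R) \<subseteq> fast_set f (\<lambda>n. (max_min_mod f ^^ n) r)"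
    using assms by (intro fast_set_max_min_mod_subset)
  also have "\<dots> \<subseteq> fast_set f (\<lambda>n. (min_mod f ^^ n) r)"
    using assms by (intro fast_set_antimono funpow_min_mod_le)
  finally show "fast_set f (\<lambda>n. (max_min_mod f ^^ n) R) \<subseteq> fast_set f (\<lambda>n. (min_mod f ^^ n) r)" .
  show "fast_set f (\<lambda>n. (min_mod f ^^ n) r) \<subseteq> fast_set f (\<lambda>n. (max_min_mod f ^^ n) R)"
    using ge by (rule fast_set_antimono)
qed

end

theorem theorem1p2:
  fixes f :: "complex \<Rightarrow> complex"
  assumes "transcendental_entire f"
    and "\<exists>\<rho>>0. filterlim (\<lambda>n. (min_mod f ^^ n) \<rho>) at_top sequentially"
  shows
    "(\<exists>R>0. filterlim (\<lambda>n. (max_min_mod f ^^ n) R) at_top sequentially) \<and>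
     (\<forall>R>0. filterlim (\<lambda>n. (max_min_mod f ^^ n) R) at_top sequentially \<longrightarrow>
        (\<exists>r\<ge>R. \<forall>n\<ge>1. (min_mod f ^^ n) r \<ge> (max_min_mod f ^^ n) R)) \<and>
     (\<forall>R>0. \<forall>r\<ge>0.
        filterlim (\<lambda>n. (max_min_mod f ^^ n) R) at_top sequentially \<and>
        (\<forall>n\<ge>1. (min_mod f ^^ n) r \<ge> (max_min_mod f ^^ n) R) \<longrightarrow>
          (\<forall>R'>0. \<forall>r'\<ge>0.
             filterlim (\<lambda>n. (max_min_mod f ^^ n) R') at_top sequentially \<and>
             (\<forall>n\<ge>1. (min_mod f ^^ n) r' \<ge> (max_min_mod f ^^ n) R') \<longrightarrow>
               (\<Union>l. (f ^^ l) -` {z. \<forall>n\<ge>1. norm ((f ^^ n) z) \<ge> (max_min_mod f ^^ n) R'}) =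
               (\<Union>l. (f ^^ l) -` {z. \<forall>n\<ge>1. norm ((f ^^ n) z) \<ge> (max_min_mod f ^^ n) R})) \<and>
          (\<Union>l. (f ^^ l) -` {z. \<forall>n\<ge>1. norm ((f ^^ n) z) \<ge> (max_min_mod f ^^ n) R}) =
          (\<Union>l. (f ^^ l) -` {z. \<forall>n\<ge>1. norm ((f ^^ n) z) \<ge> (min_mod f ^^ n) r}))"
proof -
  have f: "continuous_on UNIV f"
    using assms(1) by (simp add: transcendental_entire_def holomorphic_on_imp_continuous_on)
  obtain \<rho> where \<rho>: "\<rho> > 0" "filterlim (\<lambda>n. (min_mod f ^^ n) \<rho>) at_top sequentially"
    using assms(2) by blast
  show ?thesis
    unfolding fast_set_def[symmetric, of f]
  proof (intro conjI allI impI; (elim conjE)?)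
    \<comment> \<open>The given radius itself serves as \<open>R\<close>, its orbit under
      \<open>max_min_mod f\<close> dominating the one under \<open>min_mod f\<close>.\<close>
    have "filterlim (\<lambda>n. (max_min_mod f ^^ n) \<rho>) at_top sequentially"
      using \<rho> funpow_min_mod_le[OF f] by (intro filterlim_at_top_mono[OF \<rho>(2)]) auto
    with \<rho>(1) show "\<exists>R>0. filterlim (\<lambda>n. (max_min_mod f ^^ n) R) at_top sequentially"
      by blast
  next
    fix R :: real
    assume "R > 0" "filterlim (\<lambda>n. (max_min_mod f ^^ n) R) at_top sequentially"
    then show "\<exists>r\<ge>R. \<forall>n\<ge>1. (min_mod f ^^ n) r \<ge> (max_min_mod f ^^ n) R"
      using min_mod_orbit_dominates[OF f, of R] by (metis less_imp_le)
  next
    fix R R' :: real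
    assume "R > 0" "filterlim (\<lambda>n. (max_min_mod f ^^ n) R) at_top sequentially"
      "R' > 0" "filterlim (\<lambda>n. (max_min_mod f ^^ n) R') at_top sequentially"
    then show "fast_set f (\<lambda>n. (max_min_mod f ^^ n) R') = fast_set f (\<lambda>n. (max_min_mod f ^^ n) R)"
      by (intro equalityI fast_set_max_min_mod_subset[OF f]) auto
  next
    fix R r :: real
    assume "R > 0" "r \<ge> 0" "filterlim (\<lambda>n. (max_min_mod f ^^ n) R) at_top sequentially"
      "\<forall>n\<ge>1. (min_mod f ^^ n) r \<ge> (max_min_mod f ^^ n) R"
    then show "fast_set f (\<lambda>n. (max_min_mod f ^^ n) R) = fast_set f (\<lambda>n. (min_mod f ^^ n) r)"
      by (intro fast_set_min_mod_eq[OF f]) auto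
  qed
qed

end
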